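(* Let $\Omega=\{\frac{1}{n}: n\in\mathbb{N}\}\cup\{0\}$, where $\mathbb{N}=\{1,2,3,\dots\}$, with the topology inherited from $\mathbb{R}$, and let $\mathcal{A}=C(\Omega)$ be the C*-algebra of continuous complex-valued functions on $\Omega$. Then $\mathcal{A}$ is scattered, but its dual Banach space $\mathcal{A}^{*}$ (with the weak* topology $\sigma(\mathcal{A}^{*},\mathcal{A})$) does not have the weak* fixed point property for left reversible semigroups.
   Context: A C*-algebra $\mathcal{A}$ is scattered if every positive linear functional on $\mathcal{A}$ is the sum of a sequence of non-negative scalar multiples of pure states. A semi-topological semigroup is a semigroup $S$ with a Hausdorff topology such that for each $a\in S$ the mappings $s\mapsto sa$ and $s\mapsto as$ from $S$ to $S$ are continuous. $S$ is left reversible if any two (non-empty) closed right ideals of $S$ have non-empty intersection. An action of $S$ on a subset $K$ of a Banach space is a mapping $(s,x)\mapsto s(x)$ from $S\times K$ to $K$ with $(st)(x)=s(t(x))$ for all $s,t\in S$, $x\in K$. It is separately continuous if it is continuous in each variable when the other is kept fixed, where $K$ carries the norm topology. It is non-expansive if $\|s(x)-s(y)\|\leq\|x-y\|$ for all $s\in S$, $x,y\in K$. A common fixed point is a point $x\in K$ with $s(x)=x$ for all $s\in S$. A dual Banach space $E$ (with a fixed predual) has the weak* fixed point property for left reversible semigroups if for every non-empty weak* compact convex subset $K$ of $E$, every non-expansive separately continuous action of a left reversible semi-topological semigroup $S$ on $K$ has a common fixed point in $K$. *)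

theory Defs
  imports "HOL-Analysis.Analysis"
begin

section \<open>Complex normed spaces and C*-algebras\<close>

class scaleC =
  fixes scaleC :: "complex \<Rightarrow> 'a \<Rightarrow> 'a"  (infixr \<open>*\<^sub>C\<close> 75)

class complex_normed_space = real_normed_vector + scaleC +
  assumes scaleC_of_real: "complex_of_real r *\<^sub>C x = r *\<^sub>R x"
    and scaleC_scaleC: "a *\<^sub>C b *\<^sub>C x = (a * b) *\<^sub>C x"
    and scaleC_add_left: "(a + b) *\<^sub>C x = a *\<^sub>C x + b *\<^sub>C x"
    and scaleC_add_right: "a *\<^sub>C (x + y) = a *\<^sub>C x + a *\<^sub>C y"
    and norm_scaleC: "norm (a *\<^sub>C x) = cmod a * norm x"

text \<open>C*-algebras are not assumed to be unital.\<close>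

class cstar_algebra = complex_normed_space + real_normed_algebra + banach +
  fixes star :: "'a \<Rightarrow> 'a"
  assumes scaleC_mult_left: "(a *\<^sub>C x) * y = a *\<^sub>C (x * y)"
    and scaleC_mult_right: "x * (a *\<^sub>C y) = a *\<^sub>C (x * y)"
    and star_star: "star (star x) = x"
    and star_add: "star (x + y) = star x + star y"
    and star_scaleC: "star (a *\<^sub>C x) = cnj a *\<^sub>C star x"
    and star_mult: "star (x * y) = star y * star x"
    and cstar_identity: "norm (star x * x) = (norm x)\<^sup>2"

lemma norm_star: "norm (star x) = norm (x :: 'a::cstar_algebra)"
proof -
  have le: "norm y \<le> norm (star y)" for y :: 'a
  proof (cases "y = 0")
    case False
    have "norm y * norm y \<le> norm (star y) * norm y"
      using cstar_identity[of y] norm_mult_ineq[of "star y" y] by (simp add: power2_eq_square)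
    then show ?thesis using False by simp
  qed simp
  show ?thesis using le[of x] le[of "star x"] by (simp add: star_star)
qed

lemma bounded_linear_star: "bounded_linear (star :: 'a::cstar_algebra \<Rightarrow> 'a)"
proof (rule bounded_linear_intro[where K = 1])
  fix r :: real and x :: 'a
  have "star (complex_of_real r *\<^sub>C x) = complex_of_real r *\<^sub>C star x"
    by (simp add: star_scaleC)
  then show "star (r *\<^sub>R x) = r *\<^sub>R star x" by (simp add: scaleC_of_real)
qed (simp_all add: star_add norm_star)

lemma bounded_linear_scaleC: "bounded_linear (\<lambda>x :: 'a::complex_normed_space. a *\<^sub>C x)"
proof (rule bounded_linear_intro[where K = "cmod a"])
  fix r :: real and x :: 'a
  have "a *\<^sub>C complex_of_real r *\<^sub>C x = complex_of_real r *\<^sub>C a *\<^sub>C x"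
    by (simp add: scaleC_scaleC mult.commute)
  then show "a *\<^sub>C (r *\<^sub>R x) = r *\<^sub>R (a *\<^sub>C x)" by (simp add: scaleC_of_real)
qed (simp_all add: scaleC_add_right norm_scaleC mult.commute)

instantiation complex :: cstar_algebra
begin

definition scaleC_complex :: "complex \<Rightarrow> complex \<Rightarrow> complex" where "scaleC_complex = (*)"

definition star_complex :: "complex \<Rightarrow> complex" where "star_complex = cnj"

instance
  by standard
    (simp_all add: scaleC_complex_def star_complex_def algebra_simps norm_mult
      power2_eq_square scaleR_conv_of_real)

end


section \<open>The C*-algebra of bounded continuous functions\<close>

instance bcontfun :: (metric_space, banach) banach ..

instantiation bcontfun :: (metric_space, cstar_algebra) cstar_algebra
begin

definition times_bcontfun :: "('a \<Rightarrow>\<^sub>C 'b) \<Rightarrow> ('a \<Rightarrow>\<^sub>C 'b) \<Rightarrow> 'a \<Rightarrow>\<^sub>C 'b" where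
  "times_bcontfun f g = Bcontfun (\<lambda>x. f x * g x)"

definition scaleC_bcontfun :: "complex \<Rightarrow> ('a \<Rightarrow>\<^sub>C 'b) \<Rightarrow> 'a \<Rightarrow>\<^sub>C 'b" where
  "scaleC_bcontfun a f = Bcontfun (\<lambda>x. a *\<^sub>C f x)"

definition star_bcontfun :: "('a \<Rightarrow>\<^sub>C 'b) \<Rightarrow> 'a \<Rightarrow>\<^sub>C 'b" where
  "star_bcontfun f = Bcontfun (\<lambda>x. star (f x))"

lemma apply_times_bcontfun [simp]:
  "apply_bcontfun (f * g) x = f x * g x" for f g :: "'a \<Rightarrow>\<^sub>C 'b"
proof -
  have "(\<lambda>x. f x * g x) \<in> bcontfun"
  proof (rule bcontfun_normI)
    show "continuous_on UNIV (\<lambda>x. f x * g x)" by (intro continuous_intros) auto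
    show "norm (f x * g x) \<le> norm f * norm g" for x
      by (rule order_trans[OF norm_mult_ineq]) (intro mult_mono norm_bounded norm_ge_zero)
  qed
  then show ?thesis by (simp add: times_bcontfun_def Bcontfun_inverse)
qed

lemma apply_scaleC_bcontfun [simp]:
  "apply_bcontfun (a *\<^sub>C f) x = a *\<^sub>C f x" for f :: "'a \<Rightarrow>\<^sub>C 'b"
proof -
  have "(\<lambda>x. a *\<^sub>C f x) \<in> bcontfun"
  proof (rule bcontfun_normI)
    show "continuous_on UNIV (\<lambda>x. a *\<^sub>C f x)"
      by (intro bounded_linear.continuous_on[OF bounded_linear_scaleC]) auto
    show "norm (a *\<^sub>C f x) \<le> cmod a * norm f" for x
      by (simp add: norm_scaleC mult_left_mono norm_bounded)
  qed
  then show ?thesis by (simp add: scaleC_bcontfun_def Bcontfun_inverse)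
qed

lemma apply_star_bcontfun [simp]:
  "apply_bcontfun (star f) x = star (f x)" for f :: "'a \<Rightarrow>\<^sub>C 'b"
proof -
  have "(\<lambda>x. star (f x)) \<in> bcontfun"
  proof (rule bcontfun_normI)
    show "continuous_on UNIV (\<lambda>x. star (f x))"
      by (intro bounded_linear.continuous_on[OF bounded_linear_star]) auto
    show "norm (star (f x)) \<le> norm f" for x
      by (simp add: norm_star norm_bounded)
  qed
  then show ?thesis by (simp add: star_bcontfun_def Bcontfun_inverse)
qed

instance
proof
  fix f g h :: "'a \<Rightarrow>\<^sub>C 'b" and a b :: complex and r :: real
  show "complex_of_real r *\<^sub>C f = r *\<^sub>R f"
    by (rule bcontfun_eqI) (simp add: scaleC_of_real)
  show "a *\<^sub>C b *\<^sub>C f = (a * b) *\<^sub>C f"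
    by (rule bcontfun_eqI) (simp add: scaleC_scaleC)
  show "(a + b) *\<^sub>C f = a *\<^sub>C f + b *\<^sub>C f"
    by (rule bcontfun_eqI) (simp add: scaleC_add_left)
  show "a *\<^sub>C (f + g) = a *\<^sub>C f + a *\<^sub>C g"
    by (rule bcontfun_eqI) (simp add: scaleC_add_right)
  have le: "norm (a *\<^sub>C f) \<le> cmod a * norm f" for a and f :: "'a \<Rightarrow>\<^sub>C 'b"
    by (rule norm_bound) (simp add: norm_scaleC mult_left_mono norm_bounded)
  show "norm (a *\<^sub>C f) = cmod a * norm f"
  proof (cases "a = 0")
    case False
    have "inverse a *\<^sub>C a *\<^sub>C f = f"
      using False scaleC_of_real[of 1]
      by (intro bcontfun_eqI) (simp add: scaleC_scaleC)
    then have "norm f \<le> inverse (cmod a) * norm (a *\<^sub>C f)"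
      using le[of "inverse a" "a *\<^sub>C f"] by (simp add: norm_inverse)
    then have "cmod a * norm f \<le> norm (a *\<^sub>C f)"
      using False by (simp add: field_simps)
    with le[of a f] show ?thesis by simp
  qed (use le[of a f] in simp)
  show "f * g * h = f * (g * h)"
    by (rule bcontfun_eqI) (simp add: mult.assoc)
  show "(f + g) * h = f * h + g * h" "f * (g + h) = f * g + f * h"
    by (rule bcontfun_eqI, simp add: algebra_simps)+
  show "r *\<^sub>R f * g = r *\<^sub>R (f * g)" "f * r *\<^sub>R g = r *\<^sub>R (f * g)"
    by (rule bcontfun_eqI, simp)+
  show norm_mult: "norm (f * g) \<le> norm f * norm g" for f g :: "'a \<Rightarrow>\<^sub>C 'b"
    by (rule norm_bound, simp, rule order_trans[OF norm_mult_ineq])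
      (intro mult_mono norm_bounded norm_ge_zero)
  show "(a *\<^sub>C f) * g = a *\<^sub>C (f * g)" "f * (a *\<^sub>C g) = a *\<^sub>C (f * g)"
    by (rule bcontfun_eqI, simp add: scaleC_mult_left scaleC_mult_right)+
  show "star (star f) = f"
    by (rule bcontfun_eqI) (simp add: star_star)
  show "star (f + g) = star f + star g"
    by (rule bcontfun_eqI) (simp add: star_add)
  show "star (a *\<^sub>C f) = cnj a *\<^sub>C star f"
    by (rule bcontfun_eqI) (simp add: star_scaleC)
  show "star (f * g) = star g * star f"
    by (rule bcontfun_eqI) (simp add: star_mult)
  show "norm (star f * f) = (norm f)\<^sup>2"
  proof (rule antisym)
    have "norm (star f) \<le> norm f"
      by (rule norm_bound) (simp add: norm_star norm_bounded)
    then show "norm (star f * f) \<le> (norm f)\<^sup>2"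
      using norm_mult[of "star f" f] mult_right_mono[of "norm (star f)" "norm f" "norm f"]
      by (simp add: power2_eq_square)
    have "norm f \<le> sqrt (norm (star f * f))"
    proof (rule norm_bound)
      fix x
      have "(norm (f x))\<^sup>2 \<le> norm (star f * f)"
        using norm_bounded[of "star f * f" x] by (simp add: cstar_identity)
      then show "norm (f x) \<le> sqrt (norm (star f * f))" by (rule real_le_rsqrt)
    qed
    then have "(norm f)\<^sup>2 \<le> (sqrt (norm (star f * f)))\<^sup>2"
      by (intro power_mono norm_ge_zero)
    then show "(norm f)\<^sup>2 \<le> norm (star f * f)" by simp
  qed
qed

end


section \<open>Positive functionals, pure states, scattered C*-algebras\<close>

definition clinear_functional :: "('a::complex_normed_space \<Rightarrow> complex) \<Rightarrow> bool" where
  "clinear_functional \<phi> \<longleftrightarrow>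
     (\<forall>x y. \<phi> (x + y) = \<phi> x + \<phi> y) \<and> (\<forall>c x. \<phi> (c *\<^sub>C x) = c * \<phi> x)"

text \<open>
  The positive elements of a C*-algebra are those of the form \<open>star a * a\<close>. Boundedness is
  not part of the definition.
\<close>

definition positive_functional :: "('a::cstar_algebra \<Rightarrow> complex) \<Rightarrow> bool" where
  "positive_functional \<phi> \<longleftrightarrow> clinear_functional \<phi> \<and> (\<forall>a. \<phi> (star a * a) \<in> \<real>\<^sub>\<ge>\<^sub>0)"

text \<open>
  The type \<open>'a \<Rightarrow>\<^sub>L complex\<close> consists of the bounded real-linear maps; its norm restricted to
  the complex-linear ones is the dual norm.
\<close>

definition state_space :: "('a::cstar_algebra \<Rightarrow>\<^sub>L complex) set" where
  "state_space = {\<phi>. positive_functional (blinfun_apply \<phi>) \<and> norm \<phi> = 1}"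

definition pure_state :: "('a::cstar_algebra \<Rightarrow>\<^sub>L complex) \<Rightarrow> bool" where
  "pure_state \<phi> \<longleftrightarrow> \<phi> extreme_point_of state_space"

text \<open>The series converges in the norm of the dual space.\<close>

definition scattered :: "'a::cstar_algebra itself \<Rightarrow> bool" where
  "scattered _ \<longleftrightarrow>
     (\<forall>\<phi> :: 'a \<Rightarrow> complex. positive_functional \<phi> \<longrightarrow>
       (\<exists>\<Phi> c \<psi>. blinfun_apply \<Phi> = \<phi> \<and> (\<forall>n::nat. 0 \<le> c n \<and> pure_state (\<psi> n)) \<and>
         (\<lambda>n. c n *\<^sub>R \<psi> n) sums \<Phi>))"


section \<open>The dual space and its weak* topology\<close>

definition dual_space :: "('a::complex_normed_space \<Rightarrow>\<^sub>L complex) set" where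
  "dual_space = {\<phi>. clinear_functional (blinfun_apply \<phi>)}"

text \<open>
  For scalar-valued maps \<^const>\<open>strong_operator_topology\<close> is the topology of pointwise
  convergence, i.e. the coarsest one making all evaluations continuous.
\<close>

definition weak_star_topology :: "('a::complex_normed_space \<Rightarrow>\<^sub>L complex) topology" where
  "weak_star_topology = subtopology strong_operator_topology dual_space"


section \<open>Semi-topological semigroups and their actions\<close>

text \<open>A semigroup is given by a topology on its carrier \<open>topspace T\<close> and a multiplication.\<close>

definition semitopological_semigroup :: "'s topology \<Rightarrow> ('s \<Rightarrow> 's \<Rightarrow> 's) \<Rightarrow> bool" where
  "semitopological_semigroup T m \<longleftrightarrow>
     (\<forall>s\<in>topspace T. \<forall>t\<in>topspace T. m s t \<in> topspace T) \<and>
     (\<forall>s\<in>topspace T. \<forall>t\<in>topspace T. \<forall>u\<in>topspace T. m (m s t) u = m s (m t u)) \<and>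
     Hausdorff_space T \<and>
     (\<forall>a\<in>topspace T. continuous_map T T (\<lambda>s. m s a) \<and> continuous_map T T (\<lambda>s. m a s))"

definition closed_right_ideal :: "'s topology \<Rightarrow> ('s \<Rightarrow> 's \<Rightarrow> 's) \<Rightarrow> 's set \<Rightarrow> bool" where
  "closed_right_ideal T m I \<longleftrightarrow>
     closedin T I \<and> I \<noteq> {} \<and> (\<forall>x\<in>I. \<forall>s\<in>topspace T. m x s \<in> I)"

definition left_reversible :: "'s topology \<Rightarrow> ('s \<Rightarrow> 's \<Rightarrow> 's) \<Rightarrow> bool" where
  "left_reversible T m \<longleftrightarrow>
     (\<forall>I J. closed_right_ideal T m I \<and> closed_right_ideal T m J \<longrightarrow> I \<inter> J \<noteq> {})"

definition semigroup_action ::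
  "'s topology \<Rightarrow> ('s \<Rightarrow> 's \<Rightarrow> 's) \<Rightarrow> 'x set \<Rightarrow> ('s \<Rightarrow> 'x \<Rightarrow> 'x) \<Rightarrow> bool" where
  "semigroup_action T m K act \<longleftrightarrow>
     (\<forall>s\<in>topspace T. \<forall>x\<in>K. act s x \<in> K) \<and>
     (\<forall>s\<in>topspace T. \<forall>t\<in>topspace T. \<forall>x\<in>K. act (m s t) x = act s (act t x))"

definition separately_continuous ::
  "'s topology \<Rightarrow> 'x::real_normed_vector set \<Rightarrow> ('s \<Rightarrow> 'x \<Rightarrow> 'x) \<Rightarrow> bool" where
  "separately_continuous T K act \<longleftrightarrow>
     (\<forall>s\<in>topspace T. continuous_on K (act s)) \<and>
     (\<forall>x\<in>K. continuous_map T (top_of_set K) (\<lambda>s. act s x))"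

definition nonexpansive_action ::
  "'s topology \<Rightarrow> 'x::real_normed_vector set \<Rightarrow> ('s \<Rightarrow> 'x \<Rightarrow> 'x) \<Rightarrow> bool" where
  "nonexpansive_action T K act \<longleftrightarrow>
     (\<forall>s\<in>topspace T. \<forall>x\<in>K. \<forall>y\<in>K. norm (act s x - act s y) \<le> norm (x - y))"


section \<open>The weak* fixed point property\<close>

text \<open>
  The fixed point property of the dual of \<open>'a\<close> with respect to semigroups whose elements are
  drawn from the type \<open>'s\<close>.
\<close>

definition weak_star_fpp_over ::
  "'s itself \<Rightarrow> 'a::complex_normed_space itself \<Rightarrow> bool" where
  "weak_star_fpp_over _ _ \<longleftrightarrow>
     (\<forall>(K :: ('a \<Rightarrow>\<^sub>L complex) set) (T :: 's topology) m act.
        K \<subseteq> dual_space \<and> K \<noteq> {} \<and> compactin weak_star_topology K \<and> convex K \<and>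
        semitopological_semigroup T m \<and> left_reversible T m \<and>
        semigroup_action T m K act \<and> separately_continuous T K act \<and>
        nonexpansive_action T K act
        \<longrightarrow> (\<exists>x\<in>K. \<forall>s\<in>topspace T. act s x = x))"

text \<open>
  HOL cannot quantify over all types \<open>'s\<close>. Taking the self-maps of the ambient space as \<open>'s\<close>
  loses nothing: by \<open>weak_star_fpp_imp_over\<close> below it yields the property for semigroups over
  every type.
\<close>

definition weak_star_fpp :: "'a::complex_normed_space itself \<Rightarrow> bool" where
  "weak_star_fpp _ \<longleftrightarrow>
     weak_star_fpp_over TYPE(('a \<Rightarrow>\<^sub>L complex) \<Rightarrow> ('a \<Rightarrow>\<^sub>L complex)) TYPE('a)"

theorem weak_star_fpp_imp_over:
  assumes "weak_star_fpp TYPE('a::complex_normed_space)"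
  shows "weak_star_fpp_over TYPE('s) TYPE('a)"
  unfolding weak_star_fpp_over_def
proof (intro allI impI, elim conjE)
  fix K :: "('a \<Rightarrow>\<^sub>L complex) set" and T :: "'s topology" and m act
  assume K: "K \<subseteq> dual_space" "K \<noteq> {}" "compactin weak_star_topology K" "convex K"
    and sg: "semitopological_semigroup T m" and lr: "left_reversible T m"
    and ac: "semigroup_action T m K act" and sc: "separately_continuous T K act"
    and ne: "nonexpansive_action T K act"
  define S where "S = topspace T"
  define \<rho> where "\<rho> s = (\<lambda>x. if x \<in> K then act s x else x)" for s
  define P :: "(('a \<Rightarrow>\<^sub>L complex) \<Rightarrow> ('a \<Rightarrow>\<^sub>L complex)) topology"
    where "P = product_topology (\<lambda>_. euclidean) UNIV"
  define T' where "T' = subtopology P (\<rho> ` S)"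
  have topP: "topspace P = UNIV" by (simp add: P_def)
  have top': "topspace T' = \<rho> ` S" by (simp add: T'_def topP)
  have mS: "m s t \<in> S" if "s \<in> S" "t \<in> S" for s t
    using sg that by (auto simp: semitopological_semigroup_def S_def)
  have actK: "act s x \<in> K" if "s \<in> S" "x \<in> K" for s x
    using ac that by (auto simp: semigroup_action_def S_def)
  have actm: "act (m s t) x = act s (act t x)" if "s \<in> S" "t \<in> S" "x \<in> K" for s t x
    using ac that by (auto simp: semigroup_action_def S_def)
  have \<rho>m: "\<rho> (m s t) = \<rho> s \<circ> \<rho> t" if "s \<in> S" "t \<in> S" for s t
    using that by (auto simp: \<rho>_def actm actK fun_eq_iff)
  have coord: "continuous_map T' euclidean (\<lambda>f. f x)" for x
    unfolding T'_def P_def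
    by (intro continuous_map_from_subtopology)
      (simp add: continuous_map_product_projection[of _ UNIV "\<lambda>_. euclidean"])
  have into: "continuous_map X T' g"
    if "\<And>y. y \<in> topspace X \<Longrightarrow> g y \<in> \<rho> ` S"
      and "\<And>x. continuous_map X euclidean (\<lambda>y. g y x)" for X :: "'z topology" and g
    unfolding T'_def P_def continuous_map_in_subtopology
    using that by (auto simp: continuous_map_componentwise_UNIV)
  have contS: "continuous_map T (top_of_set K) (\<lambda>s. act s x)" if "x \<in> K" for x
    using sc that by (auto simp: separately_continuous_def)
  have contK: "continuous_on K (act s)" if "s \<in> S" for s
    using sc that by (auto simp: separately_continuous_def S_def)
  have \<rho>cont: "continuous_map T T' \<rho>"
  proof (rule into)
    fix x show "continuous_map T euclidean (\<lambda>s. \<rho> s x)"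
      using contS[of x] by (cases "x \<in> K") (auto simp: \<rho>_def continuous_map_in_subtopology)
  qed (auto simp: S_def)
  have sg': "semitopological_semigroup T' (\<circ>)"
    unfolding semitopological_semigroup_def top'
  proof (intro conjI ballI)
    fix f g assume "f \<in> \<rho> ` S" "g \<in> \<rho> ` S"
    then show "f \<circ> g \<in> \<rho> ` S" by (metis (no_types, lifting) \<rho>m imageE imageI mS)
  next
    show "Hausdorff_space T'"
      unfolding T'_def P_def
      by (intro Hausdorff_space_subtopology) (simp add: Hausdorff_space_product_topology)
  next
    fix a assume a: "a \<in> \<rho> ` S"
    then obtain s where s: "s \<in> S" "a = \<rho> s" by auto
    show "continuous_map T' T' (\<lambda>f. f \<circ> a)"
    proof (rule into)
      show "f \<circ> a \<in> \<rho> ` S" if "f \<in> topspace T'" for f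
        using that s by (metis (no_types, lifting) \<rho>m imageE imageI mS top')
      show "continuous_map T' euclidean (\<lambda>f. (f \<circ> a) x)" for x
        using coord[of "a x"] by (simp add: o_def)
    qed
    show "continuous_map T' T' (\<lambda>f. a \<circ> f)"
    proof (rule into)
      show "a \<circ> f \<in> \<rho> ` S" if "f \<in> topspace T'" for f
        using that s by (metis (no_types, lifting) \<rho>m imageE imageI mS top')
      fix x
      show "continuous_map T' euclidean (\<lambda>f. (a \<circ> f) x)"
      proof (cases "x \<in> K")
        case True
        have 1: "continuous_map T' (top_of_set K) (\<lambda>f. f x)"
          using coord[of x] True actK
          by (auto simp: continuous_map_in_subtopology top' \<rho>_def)
        have 2: "continuous_map (top_of_set K) euclidean (act s)"
          using contK[OF s(1)] by simp
        have 3: "continuous_map T' euclidean (act s \<circ> (\<lambda>f. f x))"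
          by (rule continuous_map_compose[OF 1 2])
        show ?thesis
          by (rule continuous_map_eq[OF 3])
            (use True actK in \<open>auto simp: top' s \<rho>_def\<close>)
      next
        case False
        show ?thesis
          by (rule continuous_map_eq[of _ _ "\<lambda>_. x"])
            (use False in \<open>auto simp: top' s \<rho>_def\<close>)
      qed
    qed
  qed (auto simp: o_assoc)
  have pre: "closed_right_ideal T m {s \<in> S. \<rho> s \<in> I}" if I: "closed_right_ideal T' (\<circ>) I" for I
    unfolding closed_right_ideal_def
  proof (intro conjI ballI)
    show "closedin T {s \<in> S. \<rho> s \<in> I}"
      using closedin_continuous_map_preimage[OF \<rho>cont, of I] I
      by (simp add: closed_right_ideal_def S_def)
    have "I \<subseteq> \<rho> ` S" "I \<noteq> {}"
      using I closedin_subset top' by (fastforce simp: closed_right_ideal_def)+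
    then show "{s \<in> S. \<rho> s \<in> I} \<noteq> {}" by blast
    show "m x s \<in> {s \<in> S. \<rho> s \<in> I}" if "x \<in> {s \<in> S. \<rho> s \<in> I}" "s \<in> topspace T" for x s
      using I that by (auto simp: closed_right_ideal_def S_def[symmetric] top' \<rho>m mS)
  qed
  have lr': "left_reversible T' (\<circ>)"
    unfolding left_reversible_def
  proof (intro allI impI, elim conjE)
    fix I J assume "closed_right_ideal T' (\<circ>) I" "closed_right_ideal T' (\<circ>) J"
    then have "{s \<in> S. \<rho> s \<in> I} \<inter> {s \<in> S. \<rho> s \<in> J} \<noteq> {}"
      using lr pre unfolding left_reversible_def by blast
    then show "I \<inter> J \<noteq> {}" by blast
  qed
  have ac': "semigroup_action T' (\<circ>) K (\<lambda>f. f)"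
    unfolding semigroup_action_def top' by (auto simp: \<rho>_def actK)
  have sc': "separately_continuous T' K (\<lambda>f. f)"
    unfolding separately_continuous_def
  proof (intro conjI ballI)
    fix f assume "f \<in> topspace T'"
    then obtain s where s: "s \<in> S" "f = \<rho> s" by (auto simp: top')
    show "continuous_on K f"
      using contK[OF s(1)] by (rule continuous_on_eq) (simp add: s \<rho>_def)
  next
    fix x assume "x \<in> K"
    then show "continuous_map T' (top_of_set K) (\<lambda>f. f x)"
      using coord[of x] actK by (auto simp: continuous_map_in_subtopology top' \<rho>_def)
  qed
  have ne': "nonexpansive_action T' K (\<lambda>f. f)"
    using ne unfolding nonexpansive_action_def top' by (auto simp: \<rho>_def S_def)
  have "\<exists>x\<in>K. \<forall>f\<in>topspace T'. f x = x"
    using assms K sg' lr' ac' sc' ne' unfolding weak_star_fpp_def weak_star_fpp_over_def by blast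
  then show "\<exists>x\<in>K. \<forall>s\<in>topspace T. act s x = x"
    by (force simp: top' \<rho>_def S_def)
qed


section \<open>The space \<open>\<Omega>\<close>\<close>

typedef omega = "{1 / real n | n. n \<ge> 1} \<union> {0}"
  morphisms real_of_omega Abs_omega
  by blast

instantiation omega :: metric_space
begin

definition dist_omega :: "omega \<Rightarrow> omega \<Rightarrow> real" where
  "dist_omega x y = dist (real_of_omega x) (real_of_omega y)"

definition uniformity_omega :: "(omega \<times> omega) filter" where
  "uniformity_omega = (INF e\<in>{0 <..}. principal {(x, y). dist x y < e})"

definition open_omega :: "omega set \<Rightarrow> bool" where
  "open_omega U = (\<forall>x\<in>U. \<forall>\<^sub>F (x', y) in uniformity. x' = x \<longrightarrow> y \<in> U)"

instance
proof
  fix x y z :: omega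
  show "dist x y = 0 \<longleftrightarrow> x = y" by (simp add: dist_omega_def real_of_omega_inject)
  show "dist x y \<le> dist x z + dist y z" by (simp add: dist_omega_def dist_triangle2)
qed (rule uniformity_omega_def open_omega_def)+

end

lemma compact_range_real_of_omega: "compact (range real_of_omega)"
proof -
  have lim: "(\<lambda>n. 1 / real (Suc n)) \<longlonglongrightarrow> 0"
    using LIMSEQ_inverse_real_of_nat by (simp add: inverse_eq_divide)
  have "range real_of_omega = insert 0 (range (\<lambda>n. 1 / real (Suc n)))"
  proof -
    have "{1 / real n | n. n \<ge> 1} = range (\<lambda>n. 1 / real (Suc n))"
    proof (intro equalityI subsetI)
      fix x assume "x \<in> {1 / real n | n. n \<ge> 1}"
      then obtain n where "x = 1 / real n" "n \<ge> 1" by blast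
      then have "x = 1 / real (Suc (n - 1))" by simp
      then show "x \<in> range (\<lambda>n. 1 / real (Suc n))" by blast
    next
      fix x assume "x \<in> range (\<lambda>n. 1 / real (Suc n))"
      then obtain n where "x = 1 / real (Suc n)" by blast
      then show "x \<in> {1 / real n | n. n \<ge> 1}" by (intro CollectI exI[of _ "Suc n"]) simp
    qed
    then show ?thesis
      using type_definition.Rep_range[OF type_definition_omega] by auto
  qed
  with compact_sequence_with_limit[OF lim] show ?thesis by simp
qed

text \<open>The metric induces the subspace topology, and \<open>\<Omega>\<close> is compact, so that
  \<open>omega \<Rightarrow>\<^sub>C complex\<close> contains all continuous functions on \<open>\<Omega>\<close>.\<close>

lemma homeomorphism_real_of_omega:
  "homeomorphism UNIV (range real_of_omega) real_of_omega (inv real_of_omega)"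
proof -
  have inj: "inj real_of_omega" by (simp add: inj_on_def real_of_omega_inject)
  have "continuous_on UNIV real_of_omega"
    by (auto simp: continuous_on_iff dist_omega_def)
  moreover have "continuous_on (range real_of_omega) (inv real_of_omega)"
    by (auto simp: continuous_on_iff dist_omega_def inv_f_f[OF inj])
  ultimately show ?thesis
    by (simp add: homeomorphism_def inv_f_f[OF inj] image_image)
qed

lemma compact_omega: "compact (UNIV :: omega set)"
  using homeomorphism_real_of_omega compact_range_real_of_omega
  by (metis compact_continuous_image homeomorphism_def)

lemma continuous_in_bcontfun_omega:
  fixes f :: "omega \<Rightarrow> complex"
  assumes "continuous_on UNIV f"
  shows "f \<in> bcontfun"
  using assms compact_imp_bounded[OF compact_continuous_image[OF assms compact_omega]]
  by (simp add: bcontfun_def)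

end

theory Submission
  imports Defs
begin

text \<open>
  A continuous function on \<open>\<Omega>\<close> is a convergent sequence together with its limit. Expanding a function
  in the indicator functions of the isolated points \<open>1 / n\<close> shows that every positive functional on
  \<open>C(\<Omega>)\<close> is a norm convergent sum \<open>\<Sum>n. c n * \<delta>\<^sub>n\<close> of point evaluations with non-negative summable
  coefficients (\<open>positive_functional_omega_atomic\<close>), where \<open>\<delta>\<^sub>0\<close> is the evaluation at the limit point
  \<open>0\<close> and \<open>\<delta>\<^sub>n\<close> the one at \<open>1 / n\<close>. Point evaluations are pure states
  (\<open>pure_state_point_eval\<close>), so \<open>C(\<Omega>)\<close> is scattered.

  For the failure of the fixed point property, the compact convex set is the state space, which
  consists of the sums above whose coefficients add up to \<open>1\<close>. It is weak* compact by the
  Banach--Alaoglu argument (\<open>compactin_state_space\<close>). The shift sending \<open>\<Sum>n. c n * \<delta>\<^sub>n\<close> to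
  \<open>\<Sum>n. c n * \<delta>\<^sub>n\<^sub>+\<^sub>1\<close> maps it into itself and is isometric there, because the norm of such a functional
  is the \<open>\<ell>\<^sup>1\<close>-norm of its coefficients (\<open>norm_atomic\<close>). The coefficients of a fixed point satisfy
  \<open>c 0 = 0\<close> and \<open>c (n + 1) = c n\<close>, hence all vanish, which is impossible for a state. The iterates
  of the shift thus form an action, without common fixed point, of the commutative, and therefore
  left reversible, discrete semigroup of the natural numbers.
\<close>

section \<open>Positive functionals on spaces of bounded continuous functions\<close>

lemma clinear_functional_imp_linear:
  assumes "clinear_functional \<phi>"
  shows "linear \<phi>"
proof (rule linearI)
  fix x y and r :: real
  show "\<phi> (x + y) = \<phi> x + \<phi> y" using assms by (simp add: clinear_functional_def)
  have "\<phi> (r *\<^sub>R x) = \<phi> (complex_of_real r *\<^sub>C x)" by (simp add: scaleC_of_real)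
  also have "\<dots> = complex_of_real r * \<phi> x" using assms unfolding clinear_functional_def by blast
  finally show "\<phi> (r *\<^sub>R x) = r *\<^sub>R \<phi> x" by (simp add: scaleR_conv_of_real)
qed

lemma continuous_compose_bcontfun:
  fixes f :: "'a::topological_space \<Rightarrow>\<^sub>C 'b::heine_borel" and p :: "'b \<Rightarrow> 'c::metric_space"
  assumes "continuous_on UNIV p"
  shows "(\<lambda>x. p (f x)) \<in> bcontfun"
proof -
  have "compact (closure (range f))" by simp
  then have "bounded (p ` closure (range f))"
    using assms by (intro compact_imp_bounded compact_continuous_image)
      (auto intro: continuous_on_subset)
  moreover have "range (\<lambda>x. p (f x)) \<subseteq> p ` closure (range f)"
    using closure_subset[of "range f"] by blast
  ultimately have "bounded (range (\<lambda>x. p (f x)))" by (rule bounded_subset)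
  moreover have "continuous_on UNIV (\<lambda>x. p (f x))"
    by (rule continuous_on_compose2[OF assms]) auto
  ultimately show ?thesis by (simp add: bcontfun_def)
qed

text \<open>The pointwise absolute value \<open>|f|\<close>, as a complex-valued function.\<close>

definition modulus :: "('a::topological_space \<Rightarrow>\<^sub>C complex) \<Rightarrow> 'a \<Rightarrow>\<^sub>C complex" where
  "modulus f = Bcontfun (\<lambda>x. complex_of_real (cmod (f x)))"

lemma apply_modulus [simp]: "modulus f x = complex_of_real (cmod (f x))"
  unfolding modulus_def
  by (subst Bcontfun_inverse) (auto intro!: continuous_compose_bcontfun continuous_intros)

lemma apply_const_bcontfun [simp]: "const_bcontfun c x = c"
  by transfer simp

lemma positive_functional_imp_linear: "positive_functional \<phi> \<Longrightarrow> linear \<phi>"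
  by (simp add: positive_functional_def clinear_functional_imp_linear)

lemma positive_functional_scaleC:
  "positive_functional \<phi> \<Longrightarrow> \<phi> (c *\<^sub>C f) = c * \<phi> f"
  by (simp add: positive_functional_def clinear_functional_def)

text \<open>Positivity is defined through the elements \<open>star a * a\<close>; every pointwise non-negative function
  has this form, with \<open>a\<close> its pointwise square root.\<close>

lemma positive_functional_nonneg:
  fixes \<phi> :: "('a::metric_space \<Rightarrow>\<^sub>C complex) \<Rightarrow> complex" and f :: "'a \<Rightarrow>\<^sub>C complex"
  assumes "positive_functional \<phi>" and nonneg: "\<And>x. f x \<in> \<real>\<^sub>\<ge>\<^sub>0"
  shows "\<phi> f \<in> \<real>\<^sub>\<ge>\<^sub>0"
proof -
  have "(\<lambda>x. complex_of_real (sqrt (Re (f x)))) \<in> bcontfun"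
    by (intro continuous_compose_bcontfun[of "\<lambda>z. complex_of_real (sqrt (Re z))"] continuous_intros)
  then obtain a :: "'a \<Rightarrow>\<^sub>C complex" where a: "\<And>x. a x = complex_of_real (sqrt (Re (f x)))"
    by (metis bcontfunE)
  have "star a * a = f"
  proof (rule bcontfun_eqI)
    fix x
    have "f x = complex_of_real (Re (f x))" "0 \<le> Re (f x)"
      using nonneg[of x] by (auto simp: complex_nonneg_Reals_iff complex_eq_iff)
    then show "(star a * a) x = f x"
      by (metis a abs_of_nonneg apply_star_bcontfun apply_times_bcontfun complex_cnj_complex_of_real
          of_real_mult real_sqrt_mult_self star_complex_def)
  qed
  then show ?thesis using assms(1) by (metis positive_functional_def)
qed

lemma positive_functional_mono:
  fixes \<phi> :: "('a::metric_space \<Rightarrow>\<^sub>C complex) \<Rightarrow> complex" and f g :: "'a \<Rightarrow>\<^sub>C complex"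
  assumes "positive_functional \<phi>" and "\<And>x. g x - f x \<in> \<real>\<^sub>\<ge>\<^sub>0"
  shows "Re (\<phi> f) \<le> Re (\<phi> g)"
  using positive_functional_nonneg[OF assms(1), of "g - f"] assms(2)
    linear_diff[OF positive_functional_imp_linear[OF assms(1)], of g f]
  by (simp add: complex_nonneg_Reals_iff)

lemma positive_functional_real:
  fixes \<phi> :: "('a::metric_space \<Rightarrow>\<^sub>C complex) \<Rightarrow> complex" and f :: "'a \<Rightarrow>\<^sub>C complex"
  assumes pos: "positive_functional \<phi>" and real: "\<And>x. f x \<in> \<real>"
  shows "\<phi> f \<in> \<real>"
proof -
  have "(modulus f - f) x \<in> \<real>\<^sub>\<ge>\<^sub>0" for x
    using real[of x] abs_Re_le_cmod[of "f x"]
    by (auto simp: complex_nonneg_Reals_iff complex_is_Real_iff)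
  \<comment> \<open>A real \<open>f\<close> is the difference of the non-negative functions \<open>|f|\<close> and \<open>|f| - f\<close>.\<close>
  then have "\<phi> (modulus f - f) \<in> \<real>\<^sub>\<ge>\<^sub>0" by (rule positive_functional_nonneg[OF pos])
  moreover have "\<phi> (modulus f) \<in> \<real>\<^sub>\<ge>\<^sub>0"
    by (rule positive_functional_nonneg[OF pos]) simp
  ultimately show ?thesis
    using linear_diff[OF positive_functional_imp_linear[OF pos], of "modulus f" f]
    by (auto simp: complex_nonneg_Reals_iff complex_is_Real_iff)
qed

text \<open>The estimate \<open>|\<phi> f| \<le> \<phi> |f|\<close>: after multiplication of \<open>f\<close> by a unimodular constant, \<open>\<phi> f\<close> is
  non-negative, hence equal to the value of \<open>\<phi>\<close> at the real part of \<open>f\<close>, which lies below \<open>|f|\<close>.\<close>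

lemma norm_positive_functional_le_modulus:
  fixes \<phi> :: "('a::metric_space \<Rightarrow>\<^sub>C complex) \<Rightarrow> complex" and f :: "'a \<Rightarrow>\<^sub>C complex"
  assumes pos: "positive_functional \<phi>"
  shows "cmod (\<phi> f) \<le> Re (\<phi> (modulus f))"
proof -
  obtain c where c: "cmod c = 1" "c * \<phi> f = complex_of_real (cmod (\<phi> f))"
  proof (cases "\<phi> f = 0")
    case True
    then show ?thesis using that[of 1] by simp
  next
    case False
    then have "cmod (cnj (sgn (\<phi> f))) = 1" by (simp add: norm_sgn)
    moreover have "cnj (sgn (\<phi> f)) * \<phi> f = complex_of_real (cmod (\<phi> f))"
      using False complex_norm_square[of "\<phi> f"]
      by (simp add: sgn_div_norm scaleR_conv_of_real field_simps power2_eq_square)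
    ultimately show ?thesis by (rule that)
  qed
  define h where "h = c *\<^sub>C f"
  have ex: "\<exists>g::'a \<Rightarrow>\<^sub>C complex. \<forall>x. g x = complex_of_real (p (h x))"
    if "continuous_on UNIV p" for p
  proof -
    have "(\<lambda>x. complex_of_real (p (h x))) \<in> bcontfun"
      by (intro continuous_compose_bcontfun[of "\<lambda>z. complex_of_real (p z)"] continuous_intros that)
    then show ?thesis by (metis bcontfunE)
  qed
  from ex[of Re] ex[of Im] obtain u v :: "'a \<Rightarrow>\<^sub>C complex"
    where u: "\<And>x. u x = complex_of_real (Re (h x))"
      and v: "\<And>x. v x = complex_of_real (Im (h x))"
    by (auto simp: continuous_on_Re continuous_on_Im)
  have "h = u + \<i> *\<^sub>C v"
    by (rule bcontfun_eqI) (simp add: u v scaleC_complex_def complex_eq)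
  then have "\<phi> h = \<phi> u + \<i> * \<phi> v"
    using linear_add[OF positive_functional_imp_linear[OF pos]] positive_functional_scaleC[OF pos]
    by simp
  moreover have "\<phi> v \<in> \<real>" by (rule positive_functional_real[OF pos]) (simp add: v)
  ultimately have "Re (\<phi> h) = Re (\<phi> u)" by (simp add: complex_is_Real_iff)
  also have "\<dots> \<le> Re (\<phi> (modulus f))"
  proof (rule positive_functional_mono[OF pos])
    fix x
    have "cmod (f x) = cmod (h x)"
      by (simp add: h_def scaleC_complex_def norm_mult c)
    then show "modulus f x - u x \<in> \<real>\<^sub>\<ge>\<^sub>0"
      using complex_Re_le_cmod[of "h x"] by (simp add: u complex_nonneg_Reals_iff)
  qed
  finally show ?thesis
    by (simp add: h_def positive_functional_scaleC[OF pos] c)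
qed

lemma norm_positive_functional_le:
  fixes \<phi> :: "('a::metric_space \<Rightarrow>\<^sub>C complex) \<Rightarrow> complex" and f :: "'a \<Rightarrow>\<^sub>C complex"
  assumes pos: "positive_functional \<phi>"
  shows "cmod (\<phi> f) \<le> norm f * Re (\<phi> (const_bcontfun 1))"
proof -
  have "Re (\<phi> (modulus f)) \<le> Re (\<phi> (norm f *\<^sub>R const_bcontfun 1))"
    using norm_bounded[of f]
    by (intro positive_functional_mono[OF pos]) (simp add: complex_nonneg_Reals_iff)
  with norm_positive_functional_le_modulus[OF pos, of f] show ?thesis
    by (simp add: linear_scale[OF positive_functional_imp_linear[OF pos]])
qed

text \<open>Positive functionals are automatically bounded.\<close>

lemma bounded_linear_positive_functional:
  fixes \<phi> :: "('a::metric_space \<Rightarrow>\<^sub>C complex) \<Rightarrow> complex"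
  assumes pos: "positive_functional \<phi>"
  shows "bounded_linear \<phi>"
  using norm_positive_functional_le[OF pos]
    linear_add[OF positive_functional_imp_linear[OF pos]]
    linear_scale[OF positive_functional_imp_linear[OF pos]]
  by (intro bounded_linear_intro) auto

lemma norm_const_bcontfun_one: "norm (const_bcontfun 1 :: 'a::metric_space \<Rightarrow>\<^sub>C complex) = 1"
proof (rule antisym)
  show "norm (const_bcontfun 1 :: 'a \<Rightarrow>\<^sub>C complex) \<le> 1" by (rule norm_bound) simp
  show "1 \<le> norm (const_bcontfun 1 :: 'a \<Rightarrow>\<^sub>C complex)"
    using norm_bounded[of "const_bcontfun 1 :: 'a \<Rightarrow>\<^sub>C complex" undefined] by simp
qed

lemma positive_functional_one_nonneg:
  fixes \<phi> :: "('a::metric_space \<Rightarrow>\<^sub>C complex) \<Rightarrow> complex"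
  assumes "positive_functional \<phi>"
  shows "\<phi> (const_bcontfun 1) \<in> \<real>\<^sub>\<ge>\<^sub>0"
  by (rule positive_functional_nonneg[OF assms]) simp

text \<open>The norm of a positive functional is its value at the constant function \<open>1\<close>.\<close>

lemma state_space_iff:
  fixes \<Phi> :: "('a::metric_space \<Rightarrow>\<^sub>C complex) \<Rightarrow>\<^sub>L complex"
  shows "\<Phi> \<in> state_space \<longleftrightarrow> positive_functional (blinfun_apply \<Phi>) \<and> \<Phi> (const_bcontfun 1) = 1"
proof -
  have "norm \<Phi> = 1 \<longleftrightarrow> \<Phi> (const_bcontfun 1) = 1" if pos: "positive_functional (blinfun_apply \<Phi>)"
  proof -
    have "norm \<Phi> \<le> Re (\<Phi> (const_bcontfun 1))"
      using norm_positive_functional_le[OF pos] positive_functional_one_nonneg[OF pos]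
      by (intro norm_blinfun_bound) (auto simp: complex_nonneg_Reals_iff mult.commute)
    moreover have "cmod (\<Phi> (const_bcontfun 1)) \<le> norm \<Phi>"
      using norm_blinfun[of \<Phi> "const_bcontfun 1"] by (simp add: norm_const_bcontfun_one)
    moreover have "\<Phi> (const_bcontfun 1) = complex_of_real (Re (\<Phi> (const_bcontfun 1)))"
      "0 \<le> Re (\<Phi> (const_bcontfun 1))"
      using positive_functional_one_nonneg[OF pos]
      by (auto simp: complex_nonneg_Reals_iff complex_eq_iff)
    ultimately show ?thesis
      by (smt (verit) complex_Re_le_cmod one_complex.sel(1) norm_one of_real_1)
  qed
  then show ?thesis by (auto simp: state_space_def)
qed

lemma positive_functional_add:
  "positive_functional \<phi> \<Longrightarrow> positive_functional \<psi> \<Longrightarrow> positive_functional (\<lambda>f. \<phi> f + \<psi> f)"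
  by (auto simp: positive_functional_def clinear_functional_def algebra_simps)

lemma positive_functional_scaleR:
  "0 \<le> r \<Longrightarrow> positive_functional \<phi> \<Longrightarrow> positive_functional (\<lambda>f. r *\<^sub>R \<phi> f)"
  by (auto simp: positive_functional_def clinear_functional_def algebra_simps
      complex_nonneg_Reals_iff)

section \<open>The state space and its extreme points\<close>

lemma convex_state_space: "convex (state_space :: (('a::metric_space \<Rightarrow>\<^sub>C complex) \<Rightarrow>\<^sub>L complex) set)"
  unfolding convex_def
proof (intro ballI allI impI)
  fix \<Phi> \<Psi> :: "('a \<Rightarrow>\<^sub>C complex) \<Rightarrow>\<^sub>L complex" and u v :: real
  assume *: "\<Phi> \<in> state_space" "\<Psi> \<in> state_space" "0 \<le> u" "0 \<le> v" "u + v = 1"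
  then have "positive_functional (u *\<^sub>R \<Phi> + v *\<^sub>R \<Psi>)"
    using positive_functional_add[OF positive_functional_scaleR positive_functional_scaleR, of u \<Phi> v \<Psi>]
    by (simp add: state_space_iff plus_blinfun.rep_eq scaleR_blinfun.rep_eq)
  moreover have "complex_of_real u + complex_of_real v = 1"
    using *(5) by (metis of_real_1 of_real_add)
  ultimately show "u *\<^sub>R \<Phi> + v *\<^sub>R \<Psi> \<in> state_space"
    using * by (simp add: state_space_iff plus_blinfun.rep_eq scaleR_blinfun.rep_eq scaleR_conv_of_real)
qed

text \<open>The Banach--Alaoglu argument. As plain functions, the states form a closed subset of the product
  of the discs of radius \<open>norm f\<close>, which is compact by Tychonoff's theorem; since the weak*
  topology is that of pointwise convergence, turning these functions into bounded linear maps is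
  continuous.\<close>

lemma compactin_state_space:
  "compactin weak_star_topology (state_space :: (('a::metric_space \<Rightarrow>\<^sub>C complex) \<Rightarrow>\<^sub>L complex) set)"
proof -
  define C :: "(('a \<Rightarrow>\<^sub>C complex) \<Rightarrow> complex) set"
    where "C = {\<phi>. positive_functional \<phi> \<and> \<phi> (const_bcontfun 1) = 1}"
  have nn: "closed {\<phi> :: ('a \<Rightarrow>\<^sub>C complex) \<Rightarrow> complex. \<phi> a \<in> \<real>\<^sub>\<ge>\<^sub>0}" for a
    using closed_vimage[OF closed_nonneg_Reals_complex continuous_on_product_coordinates[of a]]
    by (simp add: vimage_def)
  have "closed C"
    unfolding C_def positive_functional_def clinear_functional_def
    by (intro closed_Collect_conj closed_Collect_all closed_Collect_eq nn continuous_intros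
        continuous_on_product_coordinates)
  have "compactin (product_topology (\<lambda>_. euclidean) UNIV)
      (\<Pi>\<^sub>E f\<in>UNIV. cball 0 (norm (f :: 'a \<Rightarrow>\<^sub>C complex)) :: complex set)"
    by (simp add: compactin_PiE)
  then have "compact (\<Pi>\<^sub>E f\<in>UNIV. cball 0 (norm (f :: 'a \<Rightarrow>\<^sub>C complex)) :: complex set)"
    by (simp add: euclidean_product_topology)
  moreover have "C \<subseteq> (\<Pi>\<^sub>E f\<in>UNIV. cball 0 (norm f))"
    using norm_positive_functional_le by (fastforce simp: C_def)
  ultimately have "compact C"
    using \<open>closed C\<close> by (metis compact_Int_closed inf.absorb_iff2)
  then have "compactin (top_of_set C) C" by (simp add: compactin_subtopology)
  moreover have "continuous_map (top_of_set C) weak_star_topology Blinfun"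
    unfolding weak_star_topology_def continuous_map_in_subtopology
      continuous_on_strong_operator_topo_iff_coordinatewise
  proof (intro conjI allI)
    have *: "blinfun_apply (Blinfun \<phi>) = \<phi>" if "\<phi> \<in> C" for \<phi>
      using that by (simp add: C_def bounded_linear_Blinfun_apply bounded_linear_positive_functional)
    show "continuous_map (top_of_set C) euclidean (\<lambda>\<phi>. Blinfun \<phi> f)" for f
    proof -
      have "continuous_on C (\<lambda>\<phi>. \<phi> f)"
        by (rule continuous_on_product_coordinates[THEN continuous_on_subset]) simp
      then show ?thesis by (simp add: * cong: continuous_on_cong)
    qed
    show "Blinfun \<in> topspace (top_of_set C) \<rightarrow> dual_space"
      using * by (auto simp: dual_space_def C_def positive_functional_def)
  qed
  ultimately have "compactin weak_star_topology (Blinfun ` C)"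
    by (rule image_compactin)
  also have "Blinfun ` C = state_space"
  proof (intro equalityI subsetI)
    fix \<Phi> assume "\<Phi> \<in> Blinfun ` C"
    then show "\<Phi> \<in> state_space"
      by (auto simp: C_def state_space_iff bounded_linear_Blinfun_apply
          bounded_linear_positive_functional)
  next
    fix \<Phi> :: "('a \<Rightarrow>\<^sub>C complex) \<Rightarrow>\<^sub>L complex" assume "\<Phi> \<in> state_space"
    then have "blinfun_apply \<Phi> \<in> C" by (simp add: C_def state_space_iff)
    then show "\<Phi> \<in> Blinfun ` C" by (metis blinfun_apply_inverse imageI)
  qed
  finally show ?thesis .
qed

text \<open>The evaluation \<open>f \<mapsto> f x\<close>, that is, the Dirac measure at \<open>x\<close>.\<close>

definition point_eval :: "'a::topological_space \<Rightarrow> ('a \<Rightarrow>\<^sub>C complex) \<Rightarrow>\<^sub>L complex" where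
  "point_eval x = Blinfun (\<lambda>f. apply_bcontfun f x)"

lemma apply_point_eval [simp]: "blinfun_apply (point_eval x) f = apply_bcontfun f x"
  unfolding point_eval_def
  by (subst bounded_linear_Blinfun_apply)
    (auto intro!: bounded_linear_intro[where K = 1] norm_bounded)

lemma norm_point_eval_le: "norm (point_eval x) \<le> 1"
  by (rule norm_blinfun_bound) (auto intro: norm_bounded)

lemma positive_functional_point_eval:
  "positive_functional (blinfun_apply (point_eval (x :: 'a::metric_space)))"
  by (auto simp: positive_functional_def clinear_functional_def scaleC_complex_def star_complex_def
      complex_nonneg_Reals_iff)

text \<open>If the evaluation at \<open>x\<close> is a proper convex combination of two states \<open>\<Phi>\<close> and \<open>\<Psi>\<close>, then \<open>\<Phi>\<close>
  vanishes on all non-negative functions vanishing at \<open>x\<close>. Applied to \<open>|h|\<close> for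
  \<open>h = f - f x\<close>, this gives \<open>\<Phi> h = 0\<close>, that is, \<open>\<Phi> f = f x\<close>.\<close>

lemma pure_state_point_eval: "pure_state (point_eval (x :: 'a::metric_space))"
  unfolding pure_state_def extreme_point_of_def
proof (intro conjI ballI)
  show "point_eval x \<in> state_space"
    by (simp add: state_space_iff positive_functional_point_eval)
  fix \<Phi> \<Psi> :: "('a \<Rightarrow>\<^sub>C complex) \<Rightarrow>\<^sub>L complex"
  assume st: "\<Phi> \<in> state_space" "\<Psi> \<in> state_space"
  show "point_eval x \<notin> open_segment \<Phi> \<Psi>"
  proof
    assume "point_eval x \<in> open_segment \<Phi> \<Psi>"
    then obtain u where u: "\<Phi> \<noteq> \<Psi>" "0 < u" "u < 1" "point_eval x = (1 - u) *\<^sub>R \<Phi> + u *\<^sub>R \<Psi>"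
      by (auto simp: in_segment)
    have "\<Phi> f = f x" for f :: "'a \<Rightarrow>\<^sub>C complex"
    proof -
      define h where "h = f - f x *\<^sub>C const_bcontfun 1"
      have pos: "positive_functional (blinfun_apply \<Phi>)" "positive_functional (blinfun_apply \<Psi>)"
        using st by (auto simp: state_space_iff)
      have "\<Phi> (modulus h) \<in> \<real>\<^sub>\<ge>\<^sub>0" "\<Psi> (modulus h) \<in> \<real>\<^sub>\<ge>\<^sub>0"
        by (rule positive_functional_nonneg[OF pos(1)] positive_functional_nonneg[OF pos(2)]; simp)+
      moreover have "(1 - u) * Re (\<Phi> (modulus h)) + u * Re (\<Psi> (modulus h)) = 0"
      proof -
        have "point_eval x (modulus h) = 0" by (simp add: h_def scaleC_complex_def)
        then show ?thesis
          unfolding u(4) by (simp add: plus_blinfun.rep_eq scaleR_blinfun.rep_eq complex_eq_iff)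
      qed
      ultimately have "Re (\<Phi> (modulus h)) = 0"
        using u by (smt (verit) complex_nonneg_Reals_iff mult_pos_pos mult_nonneg_nonneg)
      then have "\<Phi> h = 0"
        using norm_positive_functional_le_modulus[OF pos(1), of h] by simp
      then show ?thesis
        using st(1) by (simp add: h_def blinfun.diff_right positive_functional_scaleC[OF pos(1)]
            state_space_iff)
    qed
    then have "\<Phi> = point_eval x" by (intro blinfun_eqI) simp
    with u(4) have "\<Phi> = (1 - u) *\<^sub>R \<Phi> + u *\<^sub>R \<Psi>" by simp
    then have "u *\<^sub>R (\<Psi> - \<Phi>) = 0" by (auto simp: algebra_simps)
    with u show False by simp
  qed
qed


section \<open>Continuous functions on \<open>\<Omega>\<close> as convergent sequences\<close>

text \<open>An enumeration of \<open>\<Omega>\<close>. Since \<open>1 / 0 = 0\<close>, the limit point \<open>0\<close> of \<open>\<Omega>\<close> is \<open>pt 0\<close>, and \<open>pt n\<close> is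
  \<open>1 / n\<close> for positive \<open>n\<close>.\<close>

definition pt :: "nat \<Rightarrow> omega" where
  "pt n = Abs_omega (1 / real n)"

lemma real_of_omega_pt: "real_of_omega (pt n) = 1 / real n"
proof -
  have "1 / real n \<in> {1 / real n | n. n \<ge> 1} \<union> {0}"
    by (cases "n = 0") (auto intro!: exI[of _ n])
  then show ?thesis unfolding pt_def by (rule Abs_omega_inverse)
qed

lemma pt_eq_iff [simp]: "pt m = pt n \<longleftrightarrow> m = n"
proof -
  have "1 / real m = 1 / real n \<longleftrightarrow> m = n" by (simp add: divide_inverse)
  then show ?thesis by (metis real_of_omega_pt)
qed

lemma omega_cases: obtains n where "x = pt n"
proof -
  have "real_of_omega x = 0 \<or> (\<exists>n. real_of_omega x = 1 / real n)"
    using real_of_omega[of x] by auto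
  then have "\<exists>n. real_of_omega x = 1 / real n" by (metis div_by_0 of_nat_0)
  then show ?thesis using that by (metis real_of_omega_inject real_of_omega_pt)
qed

lemma pt_tendsto: "pt \<longlonglongrightarrow> pt 0"
proof -
  have "(\<lambda>n. dist (pt n) (pt 0)) = (\<lambda>n. 1 / real n)"
    by (simp add: dist_omega_def real_of_omega_pt fun_eq_iff)
  then show ?thesis
    using lim_1_over_n[where 'a = real] by (simp add: tendsto_dist_iff[of _ "pt 0"])
qed

lemma bcontfun_pt_tendsto: "(\<lambda>n. apply_bcontfun f (pt n)) \<longlonglongrightarrow> f (pt 0)"
  by (rule continuous_on_tendsto_compose[OF continuous_on_apply_bcontfun[of UNIV] pt_tendsto]) auto

text \<open>Together with the preceding lemma, this identifies the continuous functions on \<open>\<Omega>\<close> with the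
  sequences \<open>a\<close> converging to their entry \<open>a 0\<close>.\<close>

lemma bcontfun_omega_from_sequence:
  fixes a :: "nat \<Rightarrow> complex"
  assumes lim: "a \<longlonglongrightarrow> a 0"
  obtains f :: "omega \<Rightarrow>\<^sub>C complex" where "\<And>n. f (pt n) = a n"
proof -
  define g where "g x = a (inv pt x)" for x
  have g: "g (pt n) = a n" for n
    by (simp add: g_def inv_f_f inj_on_def)
  have "continuous_on UNIV g"
    unfolding continuous_on_iff
  proof (intro ballI allI impI)
    fix x and e :: real assume "e > 0"
    obtain n where n: "x = pt n" by (rule omega_cases)
    have "\<exists>d>0. \<forall>m. dist (pt m) (pt n) < d \<longrightarrow> dist (a m) (a n) < e"
    proof (cases "n = 0")
      case True
      obtain N where N: "\<And>m. m \<ge> N \<Longrightarrow> dist (a m) (a 0) < e"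
        using lim \<open>e > 0\<close> by (meson lim_sequentially)
      have "dist (a m) (a 0) < e" if "dist (pt m) (pt 0) < 1 / real (Suc N)" for m
      proof (cases "m = 0")
        case False
        then have "real (Suc N) < real m"
          using that by (simp add: dist_omega_def real_of_omega_pt field_simps)
        then show ?thesis by (intro N) simp
      qed (use \<open>e > 0\<close> in simp)
      then show ?thesis using True by (intro exI[of _ "1 / real (Suc N)"]) simp
    next
      case False
      \<comment> \<open>The point \<open>1 / n\<close> is isolated: its nearest neighbour in \<open>\<Omega>\<close> is \<open>1 / (n + 1)\<close>.\<close>
      have frac_bound: "1 / (a * (a + 1)) \<le> K / (a * b)"
        if "b \<le> K * (a + 1)" "0 < a" "0 < b" for a b K :: real
      proof -
        have "1 / (a * (a + 1)) * (a * b) = b / (a + 1)" using that by simp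
        also have "\<dots> \<le> K" using that by (simp add: pos_divide_le_eq)
        finally show ?thesis using that by (simp only: pos_le_divide_eq mult_pos_pos)
      qed
      have "m = n" if "dist (pt m) (pt n) < 1 / (real n * (real n + 1))" for m
      proof (rule ccontr)
        assume "m \<noteq> n"
        have "1 / (real n * (real n + 1)) \<le> \<bar>1 / real m - 1 / real n\<bar>"
        proof (cases "m = 0")
          case True
          have "1 / (real n * (real n + 1)) \<le> 1 / real n"
            using False by (intro frac_le) auto
          then show ?thesis using True by simp
        next
          case m: False
          have eq: "\<bar>1 / real m - 1 / real n\<bar> = \<bar>real n - real m\<bar> / (real n * real m)"
            using m False by (simp add: diff_frac_eq abs_mult mult.commute)
          have "real m \<le> \<bar>real n - real m\<bar> * (real n + 1)"
          proof (cases "m < n")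
            case True
            then have "1 * real m \<le> \<bar>real n - real m\<bar> * (real n + 1)"
              by (intro mult_mono) auto
            then show ?thesis by simp
          next
            case False
            with \<open>m \<noteq> n\<close> obtain k where k: "m = n + Suc k"
              by (metis less_imp_Suc_add linorder_neqE_nat add_Suc_right)
            show ?thesis by (simp add: k algebra_simps)
          qed
          then show ?thesis unfolding eq by (intro frac_bound) (use m False in auto)
        qed
        with that show False by (simp add: dist_omega_def real_of_omega_pt dist_real_def)
      qed
      then have "\<forall>m. dist (pt m) (pt n) < 1 / (real n * (real n + 1)) \<longrightarrow> dist (a m) (a n) < e"
        using \<open>e > 0\<close> by force
      moreover have "0 < 1 / (real n * (real n + 1))" using False by simp
      ultimately show ?thesis by blast
    qed
    then obtain d where "d > 0" and d: "\<And>m. dist (pt m) (pt n) < d \<Longrightarrow> dist (a m) (a n) < e"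
      by blast
    have "dist (g y) (g x) < e" if "dist y x < d" for y
    proof -
      obtain m where "y = pt m" by (rule omega_cases)
      then show ?thesis using that d by (simp add: n g)
    qed
    with \<open>d > 0\<close> show "\<exists>d>0. \<forall>x'\<in>UNIV. dist x' x < d \<longrightarrow> dist (g x') (g x) < e" by blast
  qed
  then obtain f where "g = apply_bcontfun f"
    by (metis bcontfunE continuous_in_bcontfun_omega)
  then show ?thesis using g that by metis
qed

section \<open>Functionals given by absolutely summable sequences\<close>

text \<open>The functional \<open>f \<mapsto> \<Sum>n. c n * f (pt n)\<close>, that is, the atomic measure with mass \<open>c n\<close> at
  \<open>pt n\<close>. Real masses suffice, as only differences of positive functionals occur. The definition is
  meaningful for absolutely summable \<open>c\<close>.\<close>

definition atomic :: "(nat \<Rightarrow> real) \<Rightarrow> (omega \<Rightarrow>\<^sub>C complex) \<Rightarrow>\<^sub>L complex" where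
  "atomic c = (\<Sum>n. c n *\<^sub>R point_eval (pt n))"

lemma norm_atom_le: "norm (r *\<^sub>R point_eval x) \<le> \<bar>r\<bar>"
  using norm_point_eval_le[of x] by (simp add: mult_left_le)

lemma summable_atoms:
  assumes "summable (\<lambda>n. \<bar>c n\<bar>)"
  shows "summable (\<lambda>n. c n *\<^sub>R point_eval (pt n))"
  by (rule summable_comparison_test'[OF assms]) (rule norm_atom_le)

lemma atomic_sums:
  assumes "summable (\<lambda>n. \<bar>c n\<bar>)"
  shows "(\<lambda>n. c n *\<^sub>R point_eval (pt n)) sums atomic c"
  unfolding atomic_def by (rule summable_sums[OF summable_atoms[OF assms]])

lemma apply_atomic_sums:
  fixes f :: "omega \<Rightarrow>\<^sub>C complex"
  assumes "summable (\<lambda>n. \<bar>c n\<bar>)"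
  shows "(\<lambda>n. c n *\<^sub>R f (pt n)) sums atomic c f"
  using bounded_linear.sums[OF blinfun.bounded_linear_left atomic_sums[OF assms], of f]
  by (simp add: scaleR_blinfun.rep_eq)

lemma atomic_diff:
  assumes "summable (\<lambda>n. \<bar>c n\<bar>)" "summable (\<lambda>n. \<bar>d n\<bar>)"
  shows "atomic c - atomic d = atomic (\<lambda>n. c n - d n)"
  unfolding atomic_def
  by (simp add: suminf_diff[OF summable_atoms summable_atoms] assms scaleR_diff_left)

lemma summable_abs_diff:
  fixes c d :: "nat \<Rightarrow> real"
  assumes "summable (\<lambda>n. \<bar>c n\<bar>)" "summable (\<lambda>n. \<bar>d n\<bar>)"
  shows "summable (\<lambda>n. \<bar>c n - d n\<bar>)"
  by (rule summable_comparison_test'[OF summable_add[OF assms]]) auto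

text \<open>The map \<open>atomic\<close> is isometric for the \<open>\<ell>\<^sup>1\<close>-norm. For the lower bound, a functional is tested on
  a function agreeing with the sign of \<open>c n\<close> at \<open>pt n\<close> for \<open>n < N\<close>; being constant at all the
  other points makes it continuous.\<close>

lemma norm_atomic:
  assumes sum: "summable (\<lambda>n. \<bar>c n\<bar>)"
  shows "norm (atomic c) = (\<Sum>n. \<bar>c n\<bar>)"
proof (rule antisym)
  have "norm (atomic c) \<le> (\<Sum>n. norm (c n *\<^sub>R point_eval (pt n)))"
    unfolding atomic_def
    by (intro summable_norm summable_comparison_test'[OF sum]) (use norm_atom_le in auto)
  also have "\<dots> \<le> (\<Sum>n. \<bar>c n\<bar>)"
    by (intro suminf_le norm_atom_le sum summable_comparison_test'[OF sum]) (use norm_atom_le in auto)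
  finally show "norm (atomic c) \<le> (\<Sum>n. \<bar>c n\<bar>)" .
next
  have "2 * (\<Sum>n<N. \<bar>c n\<bar>) - (\<Sum>n. \<bar>c n\<bar>) \<le> norm (atomic c)" for N
  proof -
    define s where "s n = (if n < N then sgn (c n) else sgn (c 0))" for n
    have "(\<lambda>n. complex_of_real (s n)) \<longlonglongrightarrow> complex_of_real (s 0)"
    proof (rule tendsto_eventually)
      show "\<forall>\<^sub>F n in sequentially. complex_of_real (s n) = complex_of_real (s 0)"
        using eventually_ge_at_top[of N] by eventually_elim (simp add: s_def)
    qed
    then obtain f :: "omega \<Rightarrow>\<^sub>C complex" where f: "\<And>n. f (pt n) = complex_of_real (s n)"
      using bcontfun_omega_from_sequence[of "\<lambda>n. complex_of_real (s n)"] by blast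
    have "norm f \<le> 1"
    proof (rule norm_bound)
      fix x obtain n where "x = pt n" by (rule omega_cases)
      then show "norm (f x) \<le> 1" by (simp add: f s_def sgn_real_def)
    qed
    \<comment> \<open>Termwise, \<open>c n * s n\<close> is \<open>|c n|\<close> for \<open>n < N\<close> and at least \<open>- |c n|\<close> otherwise.\<close>
    have "(\<lambda>n. 2 * (if n \<in> {..<N} then \<bar>c n\<bar> else 0) - \<bar>c n\<bar>)
        sums (2 * (\<Sum>n<N. \<bar>c n\<bar>) - (\<Sum>n. \<bar>c n\<bar>))"
      by (intro sums_diff sums_mult sums_If_finite_set summable_sums[OF sum]) simp
    moreover have "(\<lambda>n. c n * s n) sums Re (atomic c f)"
      using bounded_linear.sums[OF bounded_linear_Re apply_atomic_sums[OF sum, of f]]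
      by (simp add: f)
    moreover have "2 * (if n \<in> {..<N} then \<bar>c n\<bar> else 0) - \<bar>c n\<bar> \<le> c n * s n" for n
      by (auto simp: s_def sgn_real_def)
    ultimately have "2 * (\<Sum>n<N. \<bar>c n\<bar>) - (\<Sum>n. \<bar>c n\<bar>) \<le> Re (atomic c f)"
      by (metis (no_types, lifting) sums_le)
    also have "\<dots> \<le> norm (atomic c) * norm f"
      using complex_Re_le_cmod norm_blinfun by (rule order_trans)
    also have "\<dots> \<le> norm (atomic c)"
      using \<open>norm f \<le> 1\<close> by (simp add: mult_left_le)
    finally show ?thesis .
  qed
  moreover have "(\<lambda>N. 2 * (\<Sum>n<N. \<bar>c n\<bar>) - (\<Sum>n. \<bar>c n\<bar>))
      \<longlonglongrightarrow> 2 * (\<Sum>n. \<bar>c n\<bar>) - (\<Sum>n. \<bar>c n\<bar>)"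
    by (intro tendsto_intros summable_LIMSEQ sum)
  ultimately have "2 * (\<Sum>n. \<bar>c n\<bar>) - (\<Sum>n. \<bar>c n\<bar>) \<le> norm (atomic c)"
    by (intro LIMSEQ_le_const2) auto
  then show "(\<Sum>n. \<bar>c n\<bar>) \<le> norm (atomic c)" by simp
qed

lemma inj_on_atomic: "inj_on atomic {c. summable (\<lambda>n. \<bar>c n\<bar>)}"
proof (rule inj_onI, clarsimp)
  fix c d assume *: "summable (\<lambda>n. \<bar>c n\<bar>)" "summable (\<lambda>n. \<bar>d n\<bar>)" "atomic c = atomic d"
  then have "(\<Sum>n. \<bar>c n - d n\<bar>) = 0"
    using norm_atomic[OF summable_abs_diff[OF *(1,2)]] by (simp add: atomic_diff[symmetric])
  then have "\<bar>c n - d n\<bar> = 0" for n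
    using suminf_eq_zero_iff[OF summable_abs_diff[OF *(1,2)]] by simp
  then show "c = d" by auto
qed

lemma atomic_in_state_space:
  assumes nonneg: "\<And>n. 0 \<le> c n" and sums: "c sums 1"
  shows "atomic c \<in> state_space"
proof -
  have sum: "summable (\<lambda>n. \<bar>c n\<bar>)" using nonneg sums_summable[OF sums] by simp
  note ev = apply_atomic_sums[OF sum]
  have "atomic c (a *\<^sub>C f) = a * atomic c f" for a f
  proof (rule sums_unique2[OF ev])
    show "(\<lambda>n. c n *\<^sub>R (a *\<^sub>C f) (pt n)) sums (a * atomic c f)"
      using sums_mult[OF ev[of f], of a] by (simp add: scaleC_complex_def)
  qed
  moreover have "atomic c (star f * f) \<in> \<real>\<^sub>\<ge>\<^sub>0" for f
  proof -
    have eq: "c n *\<^sub>R (star f * f) (pt n) = complex_of_real (c n * (cmod (f (pt n)))\<^sup>2)" for n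
      unfolding of_real_mult complex_norm_square
      by (simp add: star_complex_def scaleR_conv_of_real)
    have re: "(\<lambda>n. c n * (cmod (f (pt n)))\<^sup>2) sums Re (atomic c (star f * f))"
      and im: "(\<lambda>n. 0) sums Im (atomic c (star f * f))"
      using ev[of "star f * f", unfolded eq sums_complex_iff]
      by (simp_all only: Re_complex_of_real Im_complex_of_real)
    have "0 \<le> Re (atomic c (star f * f))"
      by (rule sums_le[OF _ sums_zero re]) (simp add: nonneg)
    moreover have "Im (atomic c (star f * f)) = 0"
      by (rule sums_unique2[OF im sums_zero])
    ultimately show ?thesis by (simp add: complex_nonneg_Reals_iff)
  qed
  moreover have "atomic c (const_bcontfun 1) = 1"
  proof (rule sums_unique2[OF ev])
    show "(\<lambda>n. c n *\<^sub>R apply_bcontfun (const_bcontfun 1) (pt n)) sums (1 :: complex)"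
      using sums_of_real[OF sums, where 'a = complex] by (simp add: scaleR_conv_of_real)
  qed
  ultimately show ?thesis
    by (simp add: state_space_iff positive_functional_def clinear_functional_def blinfun.add_right)
qed

lemma apply_sum_bcontfun: "apply_bcontfun (sum F A) x = (\<Sum>i\<in>A. F i x)"
  for F :: "'i \<Rightarrow> 'a::topological_space \<Rightarrow>\<^sub>C 'b::real_normed_vector"
  by (induction A rule: infinite_finite_induct) auto

section \<open>Positive functionals on \<open>C(\<Omega>)\<close> are atomic\<close>

text \<open>The mass at the isolated point \<open>pt (Suc k)\<close> is the value of \<open>\<phi>\<close> at the indicator function
  \<open>e k\<close> of that point, and \<open>pt 0\<close> receives the remaining mass. The representation follows from
  the norm convergent expansion \<open>f = f (pt 0) + (\<Sum>k. (f (pt (Suc k)) - f (pt 0)) * e k)\<close>.\<close>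

lemma positive_functional_omega_atomic:
  fixes \<phi> :: "(omega \<Rightarrow>\<^sub>C complex) \<Rightarrow> complex"
  assumes pos: "positive_functional \<phi>"
  obtains c where "\<And>n. 0 \<le> c n" "summable c" "\<phi> = blinfun_apply (atomic c)"
proof -
  have "\<exists>e :: omega \<Rightarrow>\<^sub>C complex. \<forall>m. e (pt m) = of_bool (m = Suc k)" for k
  proof -
    have "(\<lambda>m. of_bool (m = Suc k) :: complex) \<longlonglongrightarrow> of_bool (0 = Suc k)"
    proof (rule tendsto_eventually)
      show "\<forall>\<^sub>F m in sequentially. (of_bool (m = Suc k) :: complex) = of_bool (0 = Suc k)"
        using eventually_gt_at_top[of "Suc k"] by eventually_elim simp
    qed
    then show ?thesis
      using bcontfun_omega_from_sequence[of "\<lambda>m. of_bool (m = Suc k)"] by blast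
  qed
  then obtain e :: "nat \<Rightarrow> omega \<Rightarrow>\<^sub>C complex"
    where e: "\<And>k m. e k (pt m) = of_bool (m = Suc k)" by metis
  note lin = positive_functional_imp_linear[OF pos]
  have partial: "(\<Sum>k<N. b k * e k (pt m)) = (case m of 0 \<Rightarrow> 0 | Suc j \<Rightarrow> if j < N then b j else 0)"
    for b :: "nat \<Rightarrow> complex" and N m
    by (cases m) (auto simp: e if_distrib cong: if_cong)
  define \<mu> where "\<mu> k = Re (\<phi> (e k))" for k
  have e_nonneg: "e k x \<in> \<real>\<^sub>\<ge>\<^sub>0" for k x
  proof -
    obtain m where "x = pt m" by (rule omega_cases)
    then show ?thesis by (simp add: e)
  qed
  have \<phi>e: "\<phi> (e k) = complex_of_real (\<mu> k)" and \<mu>: "0 \<le> \<mu> k" for k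
    using positive_functional_nonneg[OF pos e_nonneg, of k]
    by (auto simp: \<mu>_def complex_nonneg_Reals_iff complex_eq_iff)
  have bound: "(\<Sum>k<N. \<mu> k) \<le> Re (\<phi> (const_bcontfun 1))" for N
  proof -
    have "(\<Sum>k<N. \<mu> k) = Re (\<phi> (\<Sum>k<N. e k))"
      by (simp add: linear_sum[OF lin] \<mu>_def)
    also have "\<dots> \<le> Re (\<phi> (const_bcontfun 1))"
    proof (rule positive_functional_mono[OF pos])
      fix x
      obtain m where "x = pt m" by (rule omega_cases)
      then show "const_bcontfun 1 x - (\<Sum>k<N. e k) x \<in> \<real>\<^sub>\<ge>\<^sub>0"
        using partial[of "\<lambda>_. 1" m N] by (auto simp: apply_sum_bcontfun split: nat.splits)
    qed
    finally show ?thesis .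
  qed
  have "summable \<mu>" by (rule summableI_nonneg_bounded[OF \<mu> bound])
  define R where "R = Re (\<phi> (const_bcontfun 1))"
  have \<phi>_one: "\<phi> (const_bcontfun 1) = complex_of_real R"
    using positive_functional_one_nonneg[OF pos]
    by (auto simp: R_def complex_nonneg_Reals_iff complex_eq_iff)
  define c where "c = case_nat (R - suminf \<mu>) \<mu>"
  have c_nonneg: "0 \<le> c n" for n
    using \<mu> suminf_le_const[OF \<open>summable \<mu>\<close> bound] by (auto simp: c_def R_def split: nat.split)
  have "summable c"
    using \<open>summable \<mu>\<close> summable_Suc_iff[of c] by (simp add: c_def)
  have "\<phi> f = atomic c f" for f :: "omega \<Rightarrow>\<^sub>C complex"
  proof -
    define z where "z = f (pt 0)"
    have "(\<lambda>k. (f (pt (Suc k)) - z) *\<^sub>C e k) sums (f - z *\<^sub>C const_bcontfun 1)"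
      unfolding sums_def lim_sequentially
    proof (intro allI impI)
      fix r :: real assume "r > 0"
      then have "\<exists>M. \<forall>n\<ge>M. cmod (f (pt n) - z) < r / 2"
        using bcontfun_pt_tendsto[of f, unfolded lim_sequentially dist_norm, rule_format, of "r / 2"]
        by (simp add: z_def)
      then obtain M where M: "\<And>n. n \<ge> M \<Longrightarrow> cmod (f (pt n) - z) < r / 2" by blast
      have "dist (\<Sum>k<N. (f (pt (Suc k)) - z) *\<^sub>C e k) (f - z *\<^sub>C const_bcontfun 1) \<le> r / 2"
        if "M \<le> N" for N
      proof (rule dist_bound)
        fix x
        obtain m where "x = pt m" by (rule omega_cases)
        then show "dist ((\<Sum>k<N. (f (pt (Suc k)) - z) *\<^sub>C e k) x) ((f - z *\<^sub>C const_bcontfun 1) x)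
            \<le> r / 2"
          using M[of m] \<open>r > 0\<close> \<open>M \<le> N\<close> partial[of "\<lambda>k. f (pt (Suc k)) - z" m N]
          by (auto simp: apply_sum_bcontfun scaleC_complex_def dist_norm z_def norm_minus_commute
              split: nat.splits)
      qed
      then show "\<exists>M. \<forall>N\<ge>M. dist (\<Sum>k<N. (f (pt (Suc k)) - z) *\<^sub>C e k)
          (f - z *\<^sub>C const_bcontfun 1) < r"
        using \<open>r > 0\<close> by (intro exI[of _ M]) fastforce
    qed
    from bounded_linear.sums[OF bounded_linear_positive_functional[OF pos] this]
    have "(\<lambda>k. (f (pt (Suc k)) - z) * complex_of_real (\<mu> k))
        sums (\<phi> f - z * complex_of_real R)"
      by (simp add: positive_functional_scaleC[OF pos] linear_diff[OF lin] \<phi>e \<phi>_one)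
    from sums_add[OF this sums_mult[OF sums_of_real[OF summable_sums[OF \<open>summable \<mu>\<close>]], of z]]
    have "(\<lambda>k. c (Suc k) *\<^sub>R f (pt (Suc k)))
        sums (\<phi> f - z * complex_of_real R + z * complex_of_real (suminf \<mu>))"
      by (simp add: c_def scaleR_conv_of_real algebra_simps)
    from sums_Suc[OF this] have "(\<lambda>k. c k *\<^sub>R f (pt k)) sums \<phi> f"
      by (simp add: c_def scaleR_conv_of_real z_def algebra_simps)
    moreover have "(\<lambda>k. c k *\<^sub>R f (pt k)) sums atomic c f"
      using \<open>summable c\<close> c_nonneg by (intro apply_atomic_sums) simp
    ultimately show ?thesis by (rule sums_unique2)
  qed
  then show ?thesis using that[OF c_nonneg \<open>summable c\<close>] by blast
qed

lemma scattered_omega: "scattered TYPE(omega \<Rightarrow>\<^sub>C complex)"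
  unfolding scattered_def
proof (intro allI impI)
  fix \<phi> :: "(omega \<Rightarrow>\<^sub>C complex) \<Rightarrow> complex"
  assume "positive_functional \<phi>"
  then obtain c where c: "\<And>n. 0 \<le> c n" "summable c" "\<phi> = blinfun_apply (atomic c)"
    by (rule positive_functional_omega_atomic) blast
  have "(\<lambda>n. c n *\<^sub>R point_eval (pt n)) sums atomic c"
    using c by (intro atomic_sums) simp
  then show "\<exists>\<Phi> c \<psi>. blinfun_apply \<Phi> = \<phi> \<and> (\<forall>n::nat. 0 \<le> c n \<and> pure_state (\<psi> n)) \<and>
      (\<lambda>n. c n *\<^sub>R \<psi> n) sums \<Phi>"
    using c(1,3) pure_state_point_eval by metis
qed

section \<open>A fixed-point-free isometry of the state space\<close>

text \<open>The iterates of a non-expansive self-map form an action of the discrete additive semigroup of the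
  natural numbers, which is left reversible because it is commutative.\<close>

lemma weak_star_fpp_imp_fixed_point:
  fixes K :: "('a::complex_normed_space \<Rightarrow>\<^sub>L complex) set"
  assumes fpp: "weak_star_fpp TYPE('a)"
    and K: "K \<subseteq> dual_space" "K \<noteq> {}" "compactin weak_star_topology K" "convex K"
    and into: "\<And>x. x \<in> K \<Longrightarrow> g x \<in> K"
    and nonexp: "\<And>x y. x \<in> K \<Longrightarrow> y \<in> K \<Longrightarrow> norm (g x - g y) \<le> norm (x - y)"
  shows "\<exists>x\<in>K. g x = x"
proof -
  define T where "T = discrete_topology (UNIV :: nat set)"
  have topT: "topspace T = UNIV" by (simp add: T_def)
  have sg: "semitopological_semigroup T (+)"
    by (simp add: semitopological_semigroup_def T_def Hausdorff_space_discrete_topology)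
  have lr: "left_reversible T (+)"
    unfolding left_reversible_def closed_right_ideal_def topT
    \<comment> \<open>For \<open>x \<in> I\<close> and \<open>y \<in> J\<close>, the element \<open>x + y = y + x\<close> lies in both right ideals.\<close>
    by (metis (no_types, lifting) UNIV_I add.commute disjoint_iff ex_in_conv)
  have iter: "(g ^^ n) x \<in> K" if "x \<in> K" for n x
    using that by (induction n) (auto intro: into)
  then have act: "semigroup_action T (+) K (\<lambda>n. g ^^ n)"
    by (simp add: semigroup_action_def funpow_add)
  have iter_nonexp: "norm ((g ^^ n) x - (g ^^ n) y) \<le> norm (x - y)" if "x \<in> K" "y \<in> K" for n x y
    by (induction n) (use that iter in \<open>auto intro: order_trans[OF nonexp]\<close>)
  then have ne: "nonexpansive_action T K (\<lambda>n. g ^^ n)"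
    by (simp add: nonexpansive_action_def)
  have sc: "separately_continuous T K (\<lambda>n. g ^^ n)"
    unfolding separately_continuous_def
  proof (intro conjI ballI)
    fix n
    show "continuous_on K (g ^^ n)"
      unfolding continuous_on_iff dist_norm using iter_nonexp by (meson order_le_less_trans)
    fix x assume "x \<in> K"
    then show "continuous_map T (top_of_set K) (\<lambda>n. (g ^^ n) x)"
      using iter by (auto simp: T_def)
  qed
  have "\<exists>x\<in>K. \<forall>n\<in>topspace T. (g ^^ n) x = x"
    using weak_star_fpp_imp_over[OF fpp, where 's = nat, unfolded weak_star_fpp_over_def,
        rule_format, of K T "(+)" "\<lambda>n. g ^^ n"] K sg lr act sc ne by simp
  then obtain x where "x \<in> K" "(g ^^ 1) x = x" unfolding topT by blast
  then show ?thesis by auto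
qed

text \<open>The push-forward of atomic measures along the injection \<open>pt n \<mapsto> pt (Suc n)\<close>, which moves each
  mass \<open>c n\<close> from \<open>pt n\<close> to \<open>pt (Suc n)\<close>. As this injection of \<open>\<Omega>\<close> is discontinuous at \<open>0\<close>, the
  shift is not the adjoint of a map on \<open>C(\<Omega>)\<close>; it is defined through the sequence \<open>c\<close> representing
  the functional. Outside the range of \<open>atomic\<close> on absolutely summable sequences its value is
  irrelevant.\<close>

definition shift :: "((omega \<Rightarrow>\<^sub>C complex) \<Rightarrow>\<^sub>L complex) \<Rightarrow> (omega \<Rightarrow>\<^sub>C complex) \<Rightarrow>\<^sub>L complex" where
  "shift \<Phi> = atomic (case_nat 0 (inv_into {c. summable (\<lambda>n. \<bar>c n\<bar>)} atomic \<Phi>))"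

lemma shift_atomic:
  assumes "summable (\<lambda>n. \<bar>c n\<bar>)"
  shows "shift (atomic c) = atomic (case_nat 0 c)"
  using assms by (simp add: shift_def inv_into_f_f[OF inj_on_atomic])

lemma sums_case_nat:
  fixes c :: "nat \<Rightarrow> real"
  assumes "c sums s"
  shows "case_nat 0 c sums s"
  using sums_Suc[of "case_nat 0 c" s] assms by simp

lemma norm_shift_diff:
  assumes c: "summable (\<lambda>n. \<bar>c n\<bar>)" and d: "summable (\<lambda>n. \<bar>d n\<bar>)"
  shows "norm (shift (atomic c) - shift (atomic d)) = norm (atomic c - atomic d)"
proof -
  have eq: "(\<lambda>n. \<bar>case_nat 0 b n\<bar>) = case_nat 0 (\<lambda>n. \<bar>b n\<bar>)" for b :: "nat \<Rightarrow> real"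
    by (auto simp: fun_eq_iff split: nat.split)
  have sum: "summable (\<lambda>n. \<bar>case_nat 0 b n\<bar>)" if "summable (\<lambda>n. \<bar>b n\<bar>)" for b :: "nat \<Rightarrow> real"
    unfolding eq using sums_summable[OF sums_case_nat[OF summable_sums[OF that]]] .
  have "norm (shift (atomic c) - shift (atomic d))
      = norm (atomic (\<lambda>n. case_nat 0 c n - case_nat 0 d n))"
    by (simp add: shift_atomic c d atomic_diff sum)
  also have "(\<lambda>n. case_nat 0 c n - case_nat 0 d n) = case_nat 0 (\<lambda>n. c n - d n)"
    by (auto simp: fun_eq_iff split: nat.split)
  also have "norm (atomic (case_nat 0 (\<lambda>n. c n - d n))) = (\<Sum>n. \<bar>c n - d n\<bar>)"
    using norm_atomic[OF sum[OF summable_abs_diff[OF c d]]]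
      sums_case_nat[OF summable_sums[OF summable_abs_diff[OF c d]]]
    by (simp add: eq sums_iff)
  also have "\<dots> = norm (atomic c - atomic d)"
    by (simp add: atomic_diff c d norm_atomic summable_abs_diff)
  finally show ?thesis .
qed

lemma state_space_omega_eq:
  "(state_space :: ((omega \<Rightarrow>\<^sub>C complex) \<Rightarrow>\<^sub>L complex) set) = atomic ` {c. (\<forall>n. 0 \<le> c n) \<and> c sums 1}"
proof (intro equalityI subsetI)
  fix \<Phi> :: "(omega \<Rightarrow>\<^sub>C complex) \<Rightarrow>\<^sub>L complex"
  assume \<Phi>: "\<Phi> \<in> state_space"
  then obtain c where c: "\<And>n. 0 \<le> c n" "summable c" "blinfun_apply \<Phi> = blinfun_apply (atomic c)"
    using positive_functional_omega_atomic[of "blinfun_apply \<Phi>"] by (auto simp: state_space_iff)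
  have eq: "\<Phi> = atomic c" using c(3) by (simp only: blinfun_apply_inject)
  have "suminf c = norm (atomic c)" using c by (simp add: norm_atomic)
  also have "\<dots> = 1" using \<Phi> eq by (simp add: state_space_def)
  finally have "c sums 1" using c by (simp add: sums_iff)
  then show "\<Phi> \<in> atomic ` {c. (\<forall>n. 0 \<le> c n) \<and> c sums 1}"
    using c(1) eq by blast
qed (auto intro: atomic_in_state_space)

lemma not_weak_star_fpp_omega: "\<not> weak_star_fpp TYPE(omega \<Rightarrow>\<^sub>C complex)"
proof
  assume fpp: "weak_star_fpp TYPE(omega \<Rightarrow>\<^sub>C complex)"
  let ?K = "state_space :: ((omega \<Rightarrow>\<^sub>C complex) \<Rightarrow>\<^sub>L complex) set"
  have state: "\<exists>c. \<Phi> = atomic c \<and> (\<forall>n. 0 \<le> c n) \<and> c sums 1 \<and> summable (\<lambda>n. \<bar>c n\<bar>)"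
    if "\<Phi> \<in> ?K" for \<Phi>
    using that unfolding state_space_omega_eq by (auto simp: sums_iff)
  have "\<exists>\<Phi>\<in>?K. shift \<Phi> = \<Phi>"
  proof (rule weak_star_fpp_imp_fixed_point[OF fpp])
    show "?K \<subseteq> dual_space"
      by (auto simp: state_space_def dual_space_def positive_functional_def)
    show "?K \<noteq> {}"
      using pure_state_point_eval by (auto simp: pure_state_def extreme_point_of_def)
    show "compactin weak_star_topology ?K" "convex ?K"
      by (rule compactin_state_space convex_state_space)+
    show "shift \<Phi> \<in> ?K" if "\<Phi> \<in> ?K" for \<Phi>
      using state[OF that]
      by (auto simp: shift_atomic intro!: atomic_in_state_space sums_case_nat split: nat.split)
    show "norm (shift \<Phi> - shift \<Psi>) \<le> norm (\<Phi> - \<Psi>)" if "\<Phi> \<in> ?K" "\<Psi> \<in> ?K" for \<Phi> \<Psi>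
      using state[OF that(1)] state[OF that(2)] norm_shift_diff by auto
  qed
  then obtain \<Phi> where "\<Phi> \<in> ?K" and fixed: "shift \<Phi> = \<Phi>" by blast
  then obtain c where c: "\<Phi> = atomic c" "c sums 1" "summable (\<lambda>n. \<bar>c n\<bar>)" using state by blast
  have "summable (\<lambda>n. \<bar>case_nat 0 c n\<bar>)"
    using c(3) summable_Suc_iff[of "\<lambda>n. \<bar>case_nat 0 c n\<bar>"] by simp
  \<comment> \<open>A fixed point has \<open>c 0 = 0\<close> and \<open>c (Suc n) = c n\<close>, so that no mass remains.\<close>
  then have eq: "case_nat 0 c = c"
    using fixed c by (intro inj_onD[OF inj_on_atomic]) (auto simp: shift_atomic)
  have "c n = 0" for n
    by (induction n) (metis eq nat.case(1), metis eq nat.case(2))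
  with c(2) have "(\<lambda>_. 0 :: real) sums 1" by (simp add: fun_eq_iff[of c "\<lambda>_. 0", THEN iffD2])
  then show False by (simp add: sums_iff)
qed

theorem theorem3p9:
  shows "scattered TYPE(omega \<Rightarrow>\<^sub>C complex) \<and> \<not> weak_star_fpp TYPE(omega \<Rightarrow>\<^sub>C complex)"
  using scattered_omega not_weak_star_fpp_omega by blast

end
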